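(* Let $(F^*,\mathrm{d},\wedge)$ be a differential graded algebra, $\delta:F^n\to F^{n-1}$ a linear map for all $n$, $\Delta=\delta\,\mathrm{d}+\mathrm{d}\,\delta$, $\alpha\in\mathbb{R}$, and let $(F_{\mathbb{R}}^*,\mathrm{d}_\alpha,\wedge_\alpha)$ and $(F_{\mathbb{R}}^*,\mathrm{d}_0,\wedge_0)$ be the homotopy-deformed DGA and its $\alpha=0$ case, as defined in the context. Define $\mathcal{I}:F_{\mathbb{R}}^n\to F_{\mathbb{R}}^n$ by $$\mathcal{I}(\xi)=\xi-(-1)^n\,\alpha\,\delta(\xi)\wedge \mathrm{d}t\quad(\xi\in F^n\otimes C^\infty(\mathbb{R})),\qquad \mathcal{I}(\xi\wedge \mathrm{d}t)=\xi\wedge \mathrm{d}t\quad(\xi\in F^{n-1}\otimes C^\infty(\mathbb{R})).$$ Then $\mathcal{I}$ is an isomorphism of differential graded algebras from $(F_{\mathbb{R}}^*,\mathrm{d}_0,\wedge_0)$ to $(F_{\mathbb{R}}^*,\mathrm{d}_\alpha,\wedge_\alpha)$, with inverse given by $$\mathcal{I}^{-1}(\xi)=\xi+(-1)^n\,\alpha\,\delta(\xi)\wedge \mathrm{d}t\quad(\xi\in F^n\otimes C^\infty(\mathbb{R})),\qquad \mathcal{I}^{-1}(\xi\wedge \mathrm{d}t)=\xi\wedge \mathrm{d}t .$$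
   Context: A differential graded algebra (DGA) $(F^*,\mathrm{d},\wedge)$ consists of vector spaces $F^n$, $n\ge 0$, over $k=\mathbb{R}$ or $\mathbb{C}$ (with $F^n=0$ for $n<0$), linear maps $\mathrm{d}:F^n\to F^{n+1}$ and an associative bilinear product $\wedge:F^n\times F^m\to F^{n+m}$ with $\mathrm{d}\,\mathrm{d}=0$ and $\mathrm{d}(\xi\wedge\eta)=\mathrm{d}\xi\wedge\eta+(-1)^{|\xi|}\xi\wedge \mathrm{d}\eta$. Graded commutativity is not assumed. Put $F_{\mathbb{R}}^n=F^n\otimes C^\infty(\mathbb{R})\oplus\big(F^{n-1}\otimes C^\infty(\mathbb{R})\big)\wedge \mathrm{d}t$, where $C^\infty(\mathbb{R})$ is the algebra of smooth $k$-valued functions of time $t$, $\wedge \mathrm{d}t$ is a formal marker for the second summand, and $\mathrm{d},\wedge,\delta,\Delta$ act pointwise in $t$. For $\xi\in F^n\otimes C^\infty(\mathbb{R})$, $\eta\in F^m\otimes C^\infty(\mathbb{R})$: $\mathrm{d}_\alpha(\xi)=\mathrm{d}\xi+(-1)^n\frac{\partial\xi}{\partial t}\wedge \mathrm{d}t+(-1)^n\alpha\Delta(\xi)\wedge \mathrm{d}t$; $\mathrm{d}_\alpha(\xi\wedge \mathrm{d}t)=\mathrm{d}\xi\wedge \mathrm{d}t$; $\xi\wedge_\alpha\eta=\xi\wedge\eta-(-1)^{n+m}\alpha(\delta(\xi\wedge\eta)-\delta(\xi)\wedge\eta-(-1)^n\xi\wedge\delta(\eta))\wedge \mathrm{d}t$;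 $(\xi\wedge \mathrm{d}t)\wedge_\alpha\eta=(-1)^m(\xi\wedge\eta)\wedge \mathrm{d}t$; $\xi\wedge_\alpha(\eta\wedge \mathrm{d}t)=(\xi\wedge\eta)\wedge \mathrm{d}t$; $(\xi\wedge \mathrm{d}t)\wedge_\alpha(\eta\wedge \mathrm{d}t)=0$. These make $F_{\mathbb{R}}^*$ a DGA for every $\alpha\in\mathbb{R}$. An isomorphism of DGAs is a degree-preserving linear bijection that intertwines differentials and products. *)

theory Defs
  imports "HOL-Analysis.Analysis" "HOL-Library.Function_Algebras"
begin

(* The ground field k is a type of class real_normed_field.  By the Gelfand-Mazur theorem the
   only such fields are the real and the complex numbers, so quantifying over the type variable
   is the same as letting k be one of the two.

   A graded vector space is a family of subspaces F n (n an integer, F n = 0 for n < 0) of one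
   ambient vector space.  Nothing is assumed about how the F n meet: all operations are indexed
   by the degrees of their arguments and are only constrained on the F n, so every family of
   vector spaces is covered (embed it into its product). *)

section \<open>Differential graded algebras\<close>

definition linear_on ::
  "('k::field \<Rightarrow> 'a::ab_group_add \<Rightarrow> 'a) \<Rightarrow> 'a set \<Rightarrow> ('k \<Rightarrow> 'b::ab_group_add \<Rightarrow> 'b) \<Rightarrow> 'b set
    \<Rightarrow> ('a \<Rightarrow> 'b) \<Rightarrow> bool" where
  "linear_on s V s' W f \<longleftrightarrow>
     f ` V \<subseteq> W \<and>
     (\<forall>x\<in>V. \<forall>y\<in>V. f (x + y) = f x + f y) \<and>
     (\<forall>c. \<forall>x\<in>V. f (s c x) = s' c (f x))"

locale dga = vector_space smul
  for smul :: "'k::field \<Rightarrow> 'a::ab_group_add \<Rightarrow> 'a" +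
  fixes F :: "int \<Rightarrow> 'a set"
    and d :: "int \<Rightarrow> 'a \<Rightarrow> 'a"
    and wedge :: "int \<Rightarrow> int \<Rightarrow> 'a \<Rightarrow> 'a \<Rightarrow> 'a"
  assumes subspace_F: "subspace (F n)"
    and F_negative: "n < 0 \<Longrightarrow> F n = {0}"
    and d_linear: "linear_on smul (F n) smul (F (n + 1)) (d n)"
    and wedge_linear_left:
      "y \<in> F m \<Longrightarrow> linear_on smul (F n) smul (F (n + m)) (\<lambda>x. wedge n m x y)"
    and wedge_linear_right:
      "x \<in> F n \<Longrightarrow> linear_on smul (F m) smul (F (n + m)) (\<lambda>y. wedge n m x y)"
    and wedge_assoc:
      "\<lbrakk>x \<in> F n; y \<in> F m; z \<in> F l\<rbrakk> \<Longrightarrow>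
         wedge (n + m) l (wedge n m x y) z = wedge n (m + l) x (wedge m l y z)"
    and d_d: "x \<in> F n \<Longrightarrow> d (n + 1) (d n x) = 0"
    and Leibniz:
      "\<lbrakk>x \<in> F n; y \<in> F m\<rbrakk> \<Longrightarrow>
         d (n + m) (wedge n m x y) =
           wedge (n + 1) m (d n x) y + smul ((-1) powi n) (wedge n (m + 1) x (d m y))"

locale dga_isomorphism =
  source: dga smul F d wedge + target: dga smul' F' d' wedge'
  for smul :: "'k::field \<Rightarrow> 'a::ab_group_add \<Rightarrow> 'a"
    and F :: "int \<Rightarrow> 'a set"
    and d :: "int \<Rightarrow> 'a \<Rightarrow> 'a"
    and wedge :: "int \<Rightarrow> int \<Rightarrow> 'a \<Rightarrow> 'a \<Rightarrow> 'a"
    and smul' :: "'k \<Rightarrow> 'b::ab_group_add \<Rightarrow> 'b"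
    and F' :: "int \<Rightarrow> 'b set"
    and d' :: "int \<Rightarrow> 'b \<Rightarrow> 'b"
    and wedge' :: "int \<Rightarrow> int \<Rightarrow> 'b \<Rightarrow> 'b \<Rightarrow> 'b" +
  fixes \<phi> :: "int \<Rightarrow> 'a \<Rightarrow> 'b"
  assumes linear: "linear_on smul (F n) smul' (F' n) (\<phi> n)"
    and bijective: "bij_betw (\<phi> n) (F n) (F' n)"
    and differential: "x \<in> F n \<Longrightarrow> \<phi> (n + 1) (d n x) = d' n (\<phi> n x)"
    and product:
      "\<lbrakk>x \<in> F n; y \<in> F m\<rbrakk> \<Longrightarrow>
         \<phi> (n + m) (wedge n m x y) = wedge' n m (\<phi> n x) (\<phi> m y)"

section \<open>The tensor product with the smooth functions of time\<close>

definition time_derivative_fun :: "(real \<Rightarrow> 'k::real_normed_field) \<Rightarrow> real \<Rightarrow> 'k" where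
  "time_derivative_fun f = (\<lambda>t. vector_derivative f (at t))"

definition smooth :: "(real \<Rightarrow> 'k::real_normed_field) \<Rightarrow> bool" where
  "smooth f \<longleftrightarrow> (\<forall>n. (time_derivative_fun ^^ n) f differentiable_on UNIV)"

(* tensor_smooth smul V is the algebraic tensor product of V with the algebra of smooth
   functions, realised as the space of finite sums of t |-> f(t) x inside the functions from
   time to V.  That this space is a tensor product (universal property) is proved below as
   tensor_smooth_universal and tensor_smooth_unique. *)
definition tensor_smooth ::
  "('k::real_normed_field \<Rightarrow> 'a::ab_group_add \<Rightarrow> 'a) \<Rightarrow> 'a set \<Rightarrow> (real \<Rightarrow> 'a) set" where
  "tensor_smooth smul V =
     {\<xi>. \<exists>(N::nat) f x. (\<forall>i<N. smooth (f i) \<and> x i \<in> V) \<and>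
                        \<xi> = (\<lambda>t. \<Sum>i<N. smul (f i t) (x i))}"

(* The linear extension of f (x) |-> f' (x); the value does not depend on the chosen
   representation as a sum of elementary tensors, see time_derivative_eq. *)
definition time_derivative ::
  "('k::real_normed_field \<Rightarrow> 'a::ab_group_add \<Rightarrow> 'a) \<Rightarrow> (real \<Rightarrow> 'a) \<Rightarrow> real \<Rightarrow> 'a" where
  "time_derivative smul \<xi> =
     (THE \<eta>. \<exists>(N::nat) f x. (\<forall>i<N. smooth (f i)) \<and>
              \<xi> = (\<lambda>t. \<Sum>i<N. smul (f i t) (x i)) \<and>
              \<eta> = (\<lambda>t. \<Sum>i<N. smul (time_derivative_fun (f i) t) (x i)))"

section \<open>The homotopy-deformed differential graded algebra\<close>

(* The pair (xi, eta) of time-dependent elements stands for xi + eta /\ dt; in degree n the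
   first component has degree n and the second has degree n - 1. *)
type_synonym 'a with_dt = "(real \<Rightarrow> 'a) \<times> (real \<Rightarrow> 'a)"

definition smul_R ::
  "('k::real_normed_field \<Rightarrow> 'a::ab_group_add \<Rightarrow> 'a) \<Rightarrow> 'k \<Rightarrow> 'a with_dt \<Rightarrow> 'a with_dt" where
  "smul_R smul c = (\<lambda>(\<xi>, \<eta>). (\<lambda>t. smul c (\<xi> t), \<lambda>t. smul c (\<eta> t)))"

definition F_R ::
  "('k::real_normed_field \<Rightarrow> 'a::ab_group_add \<Rightarrow> 'a) \<Rightarrow> (int \<Rightarrow> 'a set) \<Rightarrow> int \<Rightarrow> 'a with_dt set"
  where
  "F_R smul F n = tensor_smooth smul (F n) \<times> tensor_smooth smul (F (n - 1))"

definition Laplacian ::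
  "(int \<Rightarrow> 'a::ab_group_add \<Rightarrow> 'a) \<Rightarrow> (int \<Rightarrow> 'a \<Rightarrow> 'a) \<Rightarrow> int \<Rightarrow> 'a \<Rightarrow> 'a" where
  "Laplacian d \<delta> n x = \<delta> (n + 1) (d n x) + d (n - 1) (\<delta> n x)"

definition d_deformed ::
  "('k::real_normed_field \<Rightarrow> 'a::ab_group_add \<Rightarrow> 'a) \<Rightarrow> (int \<Rightarrow> 'a \<Rightarrow> 'a) \<Rightarrow> (int \<Rightarrow> 'a \<Rightarrow> 'a)
    \<Rightarrow> real \<Rightarrow> int \<Rightarrow> 'a with_dt \<Rightarrow> 'a with_dt" where
  "d_deformed smul d \<delta> \<alpha> n = (\<lambda>(\<xi>, \<eta>).
     (\<lambda>t. d n (\<xi> t),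
      \<lambda>t. smul ((-1) powi n) (time_derivative smul \<xi> t)
          + smul ((-1) powi n * of_real \<alpha>) (Laplacian d \<delta> n (\<xi> t))
          + d (n - 1) (\<eta> t)))"

definition wedge_deformed ::
  "('k::real_normed_field \<Rightarrow> 'a::ab_group_add \<Rightarrow> 'a) \<Rightarrow> (int \<Rightarrow> int \<Rightarrow> 'a \<Rightarrow> 'a \<Rightarrow> 'a)
    \<Rightarrow> (int \<Rightarrow> 'a \<Rightarrow> 'a) \<Rightarrow> real \<Rightarrow> int \<Rightarrow> int \<Rightarrow> 'a with_dt \<Rightarrow> 'a with_dt \<Rightarrow> 'a with_dt" where
  "wedge_deformed smul wedge \<delta> \<alpha> n m = (\<lambda>(\<xi>, \<xi>') (\<eta>, \<eta>').
     (\<lambda>t. wedge n m (\<xi> t) (\<eta> t),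
      \<lambda>t. - smul ((-1) powi (n + m) * of_real \<alpha>)
              (\<delta> (n + m) (wedge n m (\<xi> t) (\<eta> t))
               - wedge (n - 1) m (\<delta> n (\<xi> t)) (\<eta> t)
               - smul ((-1) powi n) (wedge n (m - 1) (\<xi> t) (\<delta> m (\<eta> t))))
          + smul ((-1) powi m) (wedge (n - 1) m (\<xi>' t) (\<eta> t))
          + wedge n (m - 1) (\<xi> t) (\<eta>' t)))"

definition I_map ::
  "('k::real_normed_field \<Rightarrow> 'a::ab_group_add \<Rightarrow> 'a) \<Rightarrow> (int \<Rightarrow> 'a \<Rightarrow> 'a) \<Rightarrow> real
    \<Rightarrow> int \<Rightarrow> 'a with_dt \<Rightarrow> 'a with_dt" where
  "I_map smul \<delta> \<alpha> n = (\<lambda>(\<xi>, \<eta>).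
     (\<xi>, \<lambda>t. \<eta> t - smul ((-1) powi n * of_real \<alpha>) (\<delta> n (\<xi> t))))"

definition I_inverse ::
  "('k::real_normed_field \<Rightarrow> 'a::ab_group_add \<Rightarrow> 'a) \<Rightarrow> (int \<Rightarrow> 'a \<Rightarrow> 'a) \<Rightarrow> real
    \<Rightarrow> int \<Rightarrow> 'a with_dt \<Rightarrow> 'a with_dt" where
  "I_inverse smul \<delta> \<alpha> n = (\<lambda>(\<xi>, \<eta>).
     (\<xi>, \<lambda>t. \<eta> t + smul ((-1) powi n * of_real \<alpha>) (\<delta> n (\<xi> t))))"

section \<open>The function space is a tensor product and the time derivative is well defined\<close>

lemma smooth_iff:
  "smooth f \<longleftrightarrow> f differentiable_on UNIV \<and> smooth (time_derivative_fun f)"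
  unfolding smooth_def
proof safe
  assume a: "\<forall>n. (time_derivative_fun ^^ n) f differentiable_on UNIV"
  show "f differentiable_on UNIV" using spec[OF a, of 0] by simp
  fix n show "(time_derivative_fun ^^ n) (time_derivative_fun f) differentiable_on UNIV"
    using spec[OF a, of "Suc n"] by (simp add: funpow_swap1)
next
  fix n
  assume b: "f differentiable_on UNIV"
    and a: "\<forall>n. (time_derivative_fun ^^ n) (time_derivative_fun f) differentiable_on UNIV"
  show "(time_derivative_fun ^^ n) f differentiable_on UNIV"
    using b spec[OF a, of "n - 1"] by (cases n) (auto simp: funpow_swap1)
qed

lemma smooth_has_derivative:
  "smooth f \<Longrightarrow> (f has_vector_derivative time_derivative_fun f t) (at t)"
  by (simp add: smooth_iff[of f] time_derivative_fun_def differentiable_on_def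
      vector_derivative_works[symmetric])

lemma time_derivative_fun_eqI:
  "(\<And>t. (f has_vector_derivative g t) (at t)) \<Longrightarrow> time_derivative_fun f = g"
  by (auto simp: time_derivative_fun_def vector_derivative_at)

lemma time_derivative_fun_combination:
  assumes "\<And>i. i < N \<Longrightarrow> smooth (f i)"
  shows "time_derivative_fun (\<lambda>t. \<Sum>i<(N::nat). c i * f i t) =
         (\<lambda>t. \<Sum>i<N. c i * time_derivative_fun (f i) t)"
  using assms
  by (intro time_derivative_fun_eqI has_vector_derivative_sum has_vector_derivative_mult_right
      smooth_has_derivative) auto

lemma smooth_combination:
  assumes "\<And>i. i < N \<Longrightarrow> smooth (f i)"
  shows "smooth (\<lambda>t. \<Sum>i<(N::nat). c i * f i t)"
  unfolding smooth_def
proof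
  fix n
  have "(time_derivative_fun ^^ n) (\<lambda>t. \<Sum>i<N. c i * f i t) =
          (\<lambda>t. \<Sum>i<N. c i * (time_derivative_fun ^^ n) (f i) t) \<and>
        (\<forall>i<N. smooth ((time_derivative_fun ^^ n) (f i)))"
  proof (induction n)
    case 0
    then show ?case using assms by simp
  next
    case (Suc n)
    then show ?case
      using smooth_iff by (auto simp: time_derivative_fun_combination)
  qed
  moreover have "(\<lambda>t. \<Sum>i<N. c i * g i t) differentiable_on UNIV"
    if "\<forall>i<N. smooth (g i)" for g :: "nat \<Rightarrow> real \<Rightarrow> 'a"
  proof -
    have "((\<lambda>t. \<Sum>i<N. c i * g i t) has_vector_derivative
            (\<Sum>i<N. c i * time_derivative_fun (g i) t)) (at t)" for t
      using that
      by (intro has_vector_derivative_sum has_vector_derivative_mult_right smooth_has_derivative)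
        auto
    then show ?thesis
      by (auto simp: differentiable_on_def intro: differentiableI_vector)
  qed
  ultimately show "(time_derivative_fun ^^ n) (\<lambda>t. \<Sum>i<N. c i * f i t) differentiable_on UNIV"
    by auto
qed

definition bilinear_on_smooth ::
  "('k::real_normed_field \<Rightarrow> 'a::ab_group_add \<Rightarrow> 'a) \<Rightarrow> 'a set \<Rightarrow>
   ('k \<Rightarrow> 'w::ab_group_add \<Rightarrow> 'w) \<Rightarrow> ((real \<Rightarrow> 'k) \<Rightarrow> 'a \<Rightarrow> 'w) \<Rightarrow> bool" where
  "bilinear_on_smooth s V s' b \<longleftrightarrow>
     (\<forall>f. smooth f \<longrightarrow> linear_on s V s' UNIV (b f)) \<and>
     (\<forall>x\<in>V. linear_on (\<lambda>c f t. c * f t) (Collect smooth) s' UNIV (\<lambda>f. b f x))"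

lemma smooth_add: "smooth f \<Longrightarrow> smooth g \<Longrightarrow> smooth (f + g)"
  using smooth_combination[of 2 "\<lambda>i. if i = 0 then f else g" "\<lambda>_. 1"]
  by (simp add: numeral_2_eq_2 plus_fun_def)

lemma smooth_scale: "smooth f \<Longrightarrow> smooth (\<lambda>t. c * f t)"
  using smooth_combination[of 1 "\<lambda>_. f" "\<lambda>_. c"] by simp

lemma smooth_uminus: "smooth f \<Longrightarrow> smooth (\<lambda>t. - f t)"
  using smooth_scale[of f "- 1"] by simp

lemma smooth_zero: "smooth (\<lambda>_. 0)"
  using smooth_combination[of 0] by simp

lemma bilinear_on_smooth_combination:
  assumes b: "bilinear_on_smooth s V s' b" and x: "x \<in> V" and s': "vector_space s'"
    and "\<And>i. i < N \<Longrightarrow> smooth (f i)"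
  shows "b (\<lambda>t. \<Sum>i<(N::nat). c i * f i t) x = (\<Sum>i<N. s' (c i) (b (f i) x))"
  using assms(4)
proof (induction N)
  interpret W: vector_space s' by fact
  have add: "b (f + g) x = b f x + b g x" if "smooth f" "smooth g" for f g
    using b x that by (auto simp: bilinear_on_smooth_def linear_on_def)
  have scl: "b (\<lambda>t. c * f t) x = s' c (b f x)" if "smooth f" for f c
    using b x that by (auto simp: bilinear_on_smooth_def linear_on_def)
  case 0
  then show ?case using scl[OF smooth_zero, of 0] by simp
next
  interpret W: vector_space s' by fact
  have add: "b (f + g) x = b f x + b g x" if "smooth f" "smooth g" for f g
    using b x that by (auto simp: bilinear_on_smooth_def linear_on_def)
  have scl: "b (\<lambda>t. c * f t) x = s' c (b f x)" if "smooth f" for f c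
    using b x that by (auto simp: bilinear_on_smooth_def linear_on_def)
  case (Suc N)
  have "b ((\<lambda>t. \<Sum>i<N. c i * f i t) + (\<lambda>t. c N * f N t)) x =
        b (\<lambda>t. \<Sum>i<N. c i * f i t) x + b (\<lambda>t. c N * f N t) x"
    using Suc.prems by (intro add smooth_combination smooth_scale) auto
  then show ?case using Suc by (simp add: plus_fun_def scl)
qed

lemma linear_on_sum:
  assumes f: "linear_on s V s' W f" and V: "module.subspace s V"
    and s: "vector_space s" and s': "vector_space s'"
    and "finite E" "E \<subseteq> V"
  shows "f (\<Sum>e\<in>E. s (c e) e) = (\<Sum>e\<in>E. s' (c e) (f e))"
  using assms(5,6)
proof (induction E)
  interpret V: vector_space s by fact
  interpret W: vector_space s' by fact
  case empty
  have "f (s 0 0) = s' 0 (f 0)"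
    using f V.subspace_0[OF V] unfolding linear_on_def by blast
  then show ?case by simp
next
  interpret V: vector_space s by fact
  case (insert e E)
  have "f (s (c e) e + (\<Sum>e\<in>E. s (c e) e)) = f (s (c e) e) + f (\<Sum>e\<in>E. s (c e) e)"
  proof -
    have "s (c e) e \<in> V" "(\<Sum>e\<in>E. s (c e) e) \<in> V"
      using V insert.prems by (auto intro!: V.subspace_sum V.subspace_scale)
    then show ?thesis using f unfolding linear_on_def by blast
  qed
  moreover have "f (s (c e) e) = s' (c e) (f e)"
    using f insert.prems by (auto simp: linear_on_def)
  ultimately show ?case using insert by auto
qed

text \<open>A vanishing sum of elementary tensors is killed by every bilinear map.\<close>

lemma elementary_sum_zero:
  assumes s: "vector_space s" and V: "module.subspace s V" and s': "vector_space s'"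
    and b: "bilinear_on_smooth s V s' b"
    and fx: "\<And>i. i < N \<Longrightarrow> smooth (f i) \<and> x i \<in> V"
    and zero: "\<And>t. (\<Sum>i<(N::nat). s (f i t) (x i)) = 0"
  shows "(\<Sum>i<N. b (f i) (x i)) = 0"
proof -
  interpret V: vector_space s by fact
  interpret W: vector_space s' by fact
  obtain E where E: "E \<subseteq> x ` {..<N}" "V.independent E" "x ` {..<N} \<subseteq> V.span E"
    using V.maximal_independent_subset by blast
  have fin: "finite E" and EV: "E \<subseteq> V" using E(1) fx by (auto intro: finite_subset)
  define c where "c i e = V.representation E (x i) e" for i e
  have x: "x i = (\<Sum>e\<in>E. s (c i e) e)" if "i < N" for i
    unfolding c_def
    using V.sum_representation_eq[OF E(2) _ fin subset_refl, of "x i"] E(3) that by auto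
  have coeff: "(\<Sum>i<N. c i e * f i t) = 0" if "e \<in> E" for e t
  proof -
    have "0 = (\<Sum>i<N. s (f i t) (\<Sum>e\<in>E. s (c i e) e))"
      using zero[of t] x by simp
    also have "\<dots> = (\<Sum>e\<in>E. \<Sum>i<N. s (c i e * f i t) e)"
      by (subst sum.swap) (simp add: V.scale_sum_right mult.commute)
    also have "\<dots> = (\<Sum>e\<in>E. s (\<Sum>i<N. c i e * f i t) e)"
      by (simp add: V.scale_sum_left)
    finally have "(\<Sum>e\<in>E. s (\<Sum>i<N. c i e * f i t) e) = 0" by (rule sym)
    from V.independentD[OF E(2) fin subset_refl this that] show ?thesis .
  qed
  have "(\<Sum>i<N. b (f i) (x i)) = (\<Sum>i<N. \<Sum>e\<in>E. s' (c i e) (b (f i) e))"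
  proof (rule sum.cong[OF refl])
    fix i assume i: "i \<in> {..<N}"
    have "linear_on s V s' UNIV (b (f i))"
      using b fx i by (auto simp: bilinear_on_smooth_def)
    from linear_on_sum[OF this V s s' fin EV, of "c i"]
    show "b (f i) (x i) = (\<Sum>e\<in>E. s' (c i e) (b (f i) e))" using x i by simp
  qed
  also have "\<dots> = (\<Sum>e\<in>E. \<Sum>i<N. s' (c i e) (b (f i) e))" by (rule sum.swap)
  also have "\<dots> = (\<Sum>e\<in>E. b (\<lambda>t. \<Sum>i<N. c i e * f i t) e)"
    using bilinear_on_smooth_combination[OF b _ s'] fx EV by (intro sum.cong) auto
  also have "\<dots> = (\<Sum>e\<in>E. b (\<lambda>t. 0) e)"
    using coeff by (intro sum.cong) auto
  also have "\<dots> = 0"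
    using bilinear_on_smooth_combination[OF b _ s', of _ 0] EV by (intro sum.neutral) auto
  finally show ?thesis .
qed

lemma sum_append:
  fixes g h :: "nat \<Rightarrow> 'a::comm_monoid_add"
  shows "(\<Sum>i<N + M. if i < N then g i else h (i - N)) = (\<Sum>i<N. g i) + (\<Sum>i<M. h i)"
proof (induction M)
  case 0
  show ?case by (auto intro: sum.cong)
next
  case (Suc M)
  then show ?case by (simp add: add.assoc)
qed

lemma elementary_sum_eq:
  assumes s: "vector_space s" and V: "module.subspace s V" and s': "vector_space s'"
    and b: "bilinear_on_smooth s V s' b"
    and fx: "\<And>i. i < N \<Longrightarrow> smooth (f i) \<and> x i \<in> V"
    and gy: "\<And>i. i < M \<Longrightarrow> smooth (g i) \<and> y i \<in> V"
    and eq: "\<And>t. (\<Sum>i<(N::nat). s (f i t) (x i)) = (\<Sum>i<(M::nat). s (g i t) (y i))"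
  shows "(\<Sum>i<N. b (f i) (x i)) = (\<Sum>i<M. b (g i) (y i))"
proof -
  interpret V: vector_space s by fact
  interpret W: vector_space s' by fact
  define F where "F i = (if i < N then f i else (\<lambda>t. - 1 * g (i - N) t))" for i
  define X where "X i = (if i < N then x i else y (i - N))" for i
  have "(\<Sum>i<N + M. b (F i) (X i)) = 0"
  proof (rule elementary_sum_zero[OF s V s' b])
    show "smooth (F i) \<and> X i \<in> V" if "i < N + M" for i
      using that fx gy[of "i - N"] by (auto simp: F_def X_def intro: smooth_uminus)
    fix t
    have "(\<Sum>i<N + M. s (F i t) (X i)) =
          (\<Sum>i<N + M. if i < N then s (f i t) (x i) else - s (g (i - N) t) (y (i - N)))"
      by (intro sum.cong) (auto simp: F_def X_def)
    also have "\<dots> = 0"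
      using eq[of t] sum_append[where h = "\<lambda>i. - s (g i t) (y i)"]
      by (simp add: sum_negf)
    finally show "(\<Sum>i<N + M. s (F i t) (X i)) = 0" .
  qed
  moreover have "(\<Sum>i<N + M. b (F i) (X i)) =
      (\<Sum>i<N + M. if i < N then b (f i) (x i) else - b (g (i - N)) (y (i - N)))"
  proof (rule sum.cong[OF refl])
    fix i assume "i \<in> {..<N + M}"
    then have "b (\<lambda>t. - g (i - N) t) (y (i - N)) = - b (g (i - N)) (y (i - N))" if "\<not> i < N"
      using that bilinear_on_smooth_combination[OF b _ s', of "y (i - N)" 1 "\<lambda>_. g (i - N)" "\<lambda>_. - 1"]
        gy[of "i - N"]
      by auto
    then show "b (F i) (X i) = (if i < N then b (f i) (x i) else - b (g (i - N)) (y (i - N)))"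
      by (auto simp: F_def X_def)
  qed
  ultimately show ?thesis
    using sum_append[where h = "\<lambda>i. - b (g i) (y i)"] by (simp add: sum_negf)
qed

lemma tensor_smooth_elementary:
  assumes "smooth f" "x \<in> V"
  shows "(\<lambda>t. s (f t) x) \<in> tensor_smooth s V"
  using assms unfolding tensor_smooth_def
  by (auto intro!: exI[of _ "1::nat"] exI[of _ "\<lambda>_. f"] exI[of _ "\<lambda>_. x"])

theorem tensor_smooth_universal:
  assumes s: "vector_space s" and V: "module.subspace s V" and s': "vector_space s'"
    and b: "bilinear_on_smooth s V s' b"
  shows "\<exists>T. linear_on (\<lambda>c \<xi> t. s c (\<xi> t)) (tensor_smooth s V) s' UNIV T \<and>
             (\<forall>f x. smooth f \<longrightarrow> x \<in> V \<longrightarrow> T (\<lambda>t. s (f t) x) = b f x)"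
proof -
  interpret V: vector_space s by fact
  interpret W: vector_space s' by fact
  define R where "R \<xi> w \<longleftrightarrow> (\<exists>(N::nat) f x. (\<forall>i<N. smooth (f i) \<and> x i \<in> V) \<and>
      \<xi> = (\<lambda>t. \<Sum>i<N. s (f i t) (x i)) \<and> w = (\<Sum>i<N. b (f i) (x i)))" for \<xi> w
  have R_ex: "\<exists>w. R \<xi> w" if "\<xi> \<in> tensor_smooth s V" for \<xi>
    using that unfolding R_def tensor_smooth_def by blast
  have R_unique: "w = w'" if r: "R \<xi> w" "R \<xi> w'" for \<xi> w w'
  proof -
    obtain N f x where 1: "\<forall>i<(N::nat). smooth (f i) \<and> x i \<in> V"
      "\<xi> = (\<lambda>t. \<Sum>i<N. s (f i t) (x i))" "w = (\<Sum>i<N. b (f i) (x i))"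
      using r(1) unfolding R_def by blast
    obtain M g y where 2: "\<forall>i<(M::nat). smooth (g i) \<and> y i \<in> V"
      "\<xi> = (\<lambda>t. \<Sum>i<M. s (g i t) (y i))" "w' = (\<Sum>i<M. b (g i) (y i))"
      using r(2) unfolding R_def by blast
    have "(\<Sum>i<N. s (f i t) (x i)) = (\<Sum>i<M. s (g i t) (y i))" for t
      using fun_cong[OF 1(2), of t] fun_cong[OF 2(2), of t] by simp
    then show ?thesis unfolding 1(3) 2(3)
      using 1(1) 2(1) by (intro elementary_sum_eq[OF s V s' b]) auto
  qed
  define T where "T \<xi> = (SOME w. R \<xi> w)" for \<xi>
  have RT: "R \<xi> (T \<xi>)" if "\<xi> \<in> tensor_smooth s V" for \<xi>
    unfolding T_def using R_ex[OF that] by (rule someI_ex)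
  have T: "T \<xi> = w" if "R \<xi> w" for \<xi> w
    unfolding T_def using that R_unique by blast
  have "T (\<xi> + \<eta>) = T \<xi> + T \<eta>" if r: "\<xi> \<in> tensor_smooth s V" "\<eta> \<in> tensor_smooth s V" for \<xi> \<eta>
  proof -
    obtain N f x where 1: "\<forall>i<(N::nat). smooth (f i) \<and> x i \<in> V"
      "\<xi> = (\<lambda>t. \<Sum>i<N. s (f i t) (x i))" "T \<xi> = (\<Sum>i<N. b (f i) (x i))"
      using RT[OF r(1)] unfolding R_def by blast
    obtain M g y where 2: "\<forall>i<(M::nat). smooth (g i) \<and> y i \<in> V"
      "\<eta> = (\<lambda>t. \<Sum>i<M. s (g i t) (y i))" "T \<eta> = (\<Sum>i<M. b (g i) (y i))"
      using RT[OF r(2)] unfolding R_def by blast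
    let ?f = "\<lambda>i. if i < N then f i else g (i - N)"
    let ?x = "\<lambda>i. if i < N then x i else y (i - N)"
    have "(\<Sum>i<N + M. s (?f i t) (?x i)) = (\<xi> + \<eta>) t" for t
    proof -
      have "(\<Sum>i<N + M. s (?f i t) (?x i)) =
            (\<Sum>i<N + M. if i < N then s (f i t) (x i) else s (g (i - N) t) (y (i - N)))"
        by (intro sum.cong) auto
      then show ?thesis by (simp add: sum_append[where h = "\<lambda>i. s (g i t) (y i)"] 1(2) 2(2))
    qed
    moreover have "(\<Sum>i<N + M. b (?f i) (?x i)) = T \<xi> + T \<eta>"
    proof -
      have "(\<Sum>i<N + M. b (?f i) (?x i)) =
            (\<Sum>i<N + M. if i < N then b (f i) (x i) else b (g (i - N)) (y (i - N)))"
        by (intro sum.cong) auto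
      then show ?thesis by (simp add: sum_append[where h = "\<lambda>i. b (g i) (y i)"] 1(3) 2(3))
    qed
    ultimately have "R (\<xi> + \<eta>) (T \<xi> + T \<eta>)"
      unfolding R_def using 1(1) 2(1)
      by (intro exI[of _ "N + M"] exI[of _ ?f] exI[of _ ?x]) auto
    then show ?thesis by (rule T)
  qed
  moreover have "T (\<lambda>t. s c (\<xi> t)) = s' c (T \<xi>)" if r: "\<xi> \<in> tensor_smooth s V" for c \<xi>
  proof -
    obtain N f x where 1: "\<forall>i<(N::nat). smooth (f i) \<and> x i \<in> V"
      "\<xi> = (\<lambda>t. \<Sum>i<N. s (f i t) (x i))" "T \<xi> = (\<Sum>i<N. b (f i) (x i))"
      using RT[OF r] unfolding R_def by blast
    have "b (\<lambda>t. c * f i t) (x i) = s' c (b (f i) (x i))" if "i < N" for i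
      using b 1(1) that by (auto simp: bilinear_on_smooth_def linear_on_def)
    then have "R (\<lambda>t. s c (\<xi> t)) (s' c (T \<xi>))"
      unfolding R_def 1(3) using 1(1)
      by (intro exI[of _ N] exI[of _ "\<lambda>i t. c * f i t"] exI[of _ x])
        (auto simp: 1(2) V.scale_sum_right W.scale_sum_right intro: smooth_scale)
    then show ?thesis by (rule T)
  qed
  moreover have "T (\<lambda>t. s (f t) x) = b f x" if "smooth f" "x \<in> V" for f x
    using that unfolding R_def
    by (intro T, unfold R_def, intro exI[of _ "1::nat"] exI[of _ "\<lambda>_. f"] exI[of _ "\<lambda>_. x"]) auto
  ultimately show ?thesis
    by (intro exI[of _ T]) (auto simp: linear_on_def)
qed

theorem tensor_smooth_unique:
  assumes T: "linear_on (\<lambda>c \<xi> t. s c (\<xi> t)) (tensor_smooth s V) s' UNIV T"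
    and T': "linear_on (\<lambda>c \<xi> t. s c (\<xi> t)) (tensor_smooth s V) s' UNIV T'"
    and eq: "\<And>f x. smooth f \<Longrightarrow> x \<in> V \<Longrightarrow> T (\<lambda>t. s (f t) x) = T' (\<lambda>t. s (f t) x)"
    and s: "vector_space s" and s': "vector_space s'" and \<xi>: "\<xi> \<in> tensor_smooth s V"
  shows "T \<xi> = T' \<xi>"
proof -
  interpret V: vector_space s by fact
  interpret W: vector_space s' by fact
  have add: "S (\<xi> + \<eta>) = S \<xi> + S \<eta>"
    if "linear_on (\<lambda>c \<xi> t. s c (\<xi> t)) (tensor_smooth s V) s' UNIV S"
      "\<xi> \<in> tensor_smooth s V" "\<eta> \<in> tensor_smooth s V" for S \<xi> \<eta>
    using that by (simp add: linear_on_def)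
  have scl: "S (\<lambda>t. s c (\<xi> t)) = s' c (S \<xi>)"
    if "linear_on (\<lambda>c \<xi> t. s c (\<xi> t)) (tensor_smooth s V) s' UNIV S"
      "\<xi> \<in> tensor_smooth s V" for S c \<xi>
    using that by (simp add: linear_on_def)
  obtain N f x where 1: "\<forall>i<(N::nat). smooth (f i) \<and> x i \<in> V"
    "\<xi> = (\<lambda>t. \<Sum>i<N. s (f i t) (x i))"
    using \<xi> unfolding tensor_smooth_def by blast
  have mem: "(\<lambda>t. \<Sum>i<n. s (f i t) (x i)) \<in> tensor_smooth s V" if "n \<le> N" for n
    using 1(1) that unfolding tensor_smooth_def
    by (intro CollectI exI[of _ n] exI[of _ f] exI[of _ x]) auto
  have "T (\<lambda>t. \<Sum>i<n. s (f i t) (x i)) = T' (\<lambda>t. \<Sum>i<n. s (f i t) (x i))" if "n \<le> N" for n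
    using that
  proof (induction n)
    case 0
    have z: "(\<lambda>t. 0) \<in> tensor_smooth s V" using mem[of 0] by simp
    show ?case using scl[OF T z, of 0] scl[OF T' z, of 0] by simp
  next
    case (Suc n)
    let ?u = "\<lambda>t. \<Sum>i<n. s (f i t) (x i)" and ?v = "\<lambda>t. s (f n t) (x n)"
    have u: "?u \<in> tensor_smooth s V" and v: "?v \<in> tensor_smooth s V"
      using Suc.prems 1(1) by (auto intro!: mem tensor_smooth_elementary)
    have sp: "(\<lambda>t. \<Sum>i<Suc n. s (f i t) (x i)) = ?u + ?v" by (simp add: plus_fun_def)
    note add[OF T u v] add[OF T' u v]
    moreover have "T ?v = T' ?v" using eq 1(1) Suc.prems by auto
    ultimately show ?case unfolding sp using Suc by simp
  qed
  then show ?thesis using 1(2) by blast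
qed

theorem time_derivative_eq:
  fixes s :: "'k::real_normed_field \<Rightarrow> 'a::ab_group_add \<Rightarrow> 'a"
  assumes s: "vector_space s" and f: "\<And>i. i < N \<Longrightarrow> smooth (f i)"
  shows "time_derivative s (\<lambda>t. \<Sum>i<(N::nat). s (f i t) (x i)) =
         (\<lambda>t. \<Sum>i<N. s (time_derivative_fun (f i) t) (x i))"
proof -
  interpret V: vector_space s by fact
  show ?thesis
    unfolding time_derivative_def
  proof (rule the_equality)
    show "\<exists>(M::nat) g y. (\<forall>i<M. smooth (g i)) \<and>
        (\<lambda>t. \<Sum>i<N. s (f i t) (x i)) = (\<lambda>t. \<Sum>i<M. s (g i t) (y i)) \<and>
        (\<lambda>t. \<Sum>i<N. s (time_derivative_fun (f i) t) (x i)) =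
        (\<lambda>t. \<Sum>i<M. s (time_derivative_fun (g i) t) (y i))"
      using f by blast
  next
    fix \<eta>
    assume "\<exists>(M::nat) g y. (\<forall>i<M. smooth (g i)) \<and>
        (\<lambda>t. \<Sum>i<N. s (f i t) (x i)) = (\<lambda>t. \<Sum>i<M. s (g i t) (y i)) \<and>
        \<eta> = (\<lambda>t. \<Sum>i<M. s (time_derivative_fun (g i) t) (y i))"
    then obtain M g y where g: "\<forall>i<(M::nat). smooth (g i)"
      and eq: "(\<lambda>t. \<Sum>i<N. s (f i t) (x i)) = (\<lambda>t. \<Sum>i<M. s (g i t) (y i))"
      and \<eta>: "\<eta> = (\<lambda>t. \<Sum>i<M. s (time_derivative_fun (g i) t) (y i))"
      by blast
    have "(\<Sum>i<M. s (time_derivative_fun (g i) t) (y i)) =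
          (\<Sum>i<N. s (time_derivative_fun (f i) t) (x i))" for t
    proof (rule elementary_sum_eq[where V = UNIV and b = "\<lambda>f. s (time_derivative_fun f t)", OF s _ s])
      show "bilinear_on_smooth s UNIV s (\<lambda>f. s (time_derivative_fun f t))"
      proof -
        have "time_derivative_fun (f + g) = (\<lambda>t. time_derivative_fun f t + time_derivative_fun g t)"
          if "smooth f" "smooth g" for f g :: "real \<Rightarrow> 'k"
          unfolding plus_fun_def using that
          by (intro time_derivative_fun_eqI has_vector_derivative_add smooth_has_derivative)
        moreover have "time_derivative_fun (\<lambda>t. c * f t) = (\<lambda>t. c * time_derivative_fun f t)"
          if "smooth f" for c and f :: "real \<Rightarrow> 'k"
          using that
          by (intro time_derivative_fun_eqI has_vector_derivative_mult_right smooth_has_derivative)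
        ultimately show ?thesis
          by (auto simp: bilinear_on_smooth_def linear_on_def V.scale_right_distrib
              V.scale_left_distrib mult.commute)
      qed
    qed (use g f fun_cong[OF eq] in auto)
    then show "\<eta> = (\<lambda>t. \<Sum>i<N. s (time_derivative_fun (f i) t) (x i))"
      using \<eta> by auto
  qed
qed

end

theory Submission
  imports Defs
begin

text \<open>The deformation is a change of coordinates. Write \<open>(\<xi>, \<eta>)\<close> for
\<open>\<xi> + \<eta> \<and> dt\<close>. The map \<open>\<I>\<close> is a shear: it fixes the first component
and subtracts from the second a multiple of \<open>\<delta> \<xi>\<close>, so the shear with parameter
\<open>- \<alpha>\<close> undoes it. Conjugating \<open>d\<^sub>0\<close> by this shear creates the commutator terms
\<open>\<delta> d + d \<delta> = \<Delta>\<close> (lemma \<open>I_map_differential\<close>), and conjugating \<open>\<and>\<^sub>0\<close> creates the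
failure of \<open>\<delta>\<close> to be a derivation (lemma \<open>I_map_product\<close>); these are exactly the
\<open>\<alpha>\<close>-terms of \<open>d\<^sub>\<alpha>\<close> and \<open>\<and>\<^sub>\<alpha>\<close>. The time derivative does not enter these
commutators, because \<open>\<I>\<close> leaves \<open>\<xi>\<close> alone and \<open>\<and> dt\<close> kills the derivative of the
second component.

It is therefore unnecessary to verify the axioms for the deformed operations: a bijective linear
family carries the axioms of a differential graded algebra along with the operations (lemma
\<open>dga_transport\<close>). What is left is the case \<open>\<alpha> = 0\<close> (lemma \<open>dga_undeformed\<close>), where
\<open>\<delta>\<close> disappears and the axioms follow from those of \<open>F\<close> together with the product rule
\<open>\<partial>\<^sub>t (\<xi> \<and> \<eta>) = \<partial>\<^sub>t \<xi> \<and> \<eta> + \<xi> \<and> \<partial>\<^sub>t \<eta>\<close> on the tensor products with the smooth functions.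
That product rule, and the fact that linear and bilinear maps preserve these tensor products, are
obtained by inducting over sums of elementary tensors, one summand at a time (the relation
\<open>has_time_derivative\<close>); the one analytic ingredient is that a product of smooth functions is
smooth.\<close>

section \<open>Products of smooth functions\<close>

lemma smooth_derivative: "smooth f \<Longrightarrow> smooth (time_derivative_fun f)"
  using smooth_iff by blast

text \<open>A single product is not closed under differentiation, but sums of products are; the higher
derivatives of \<open>f g\<close> thus never leave this set, and the binomial expansion of the \<open>n\<close>-th
derivative is avoided.\<close>

inductive_set smooth_products :: "(real \<Rightarrow> 'k::real_normed_field) set" where
  times: "smooth f \<Longrightarrow> smooth g \<Longrightarrow> (\<lambda>t. f t * g t) \<in> smooth_products"
| plus: "p \<in> smooth_products \<Longrightarrow> q \<in> smooth_products \<Longrightarrow> (\<lambda>t. p t + q t) \<in> smooth_products"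

lemma time_derivative_fun_mult:
  assumes "smooth f" "smooth g"
  shows "time_derivative_fun (\<lambda>t. f t * g t) =
           (\<lambda>t. f t * time_derivative_fun g t + time_derivative_fun f t * g t)"
  using assms by (intro time_derivative_fun_eqI has_vector_derivative_mult smooth_has_derivative)

lemma smooth_products_derivative:
  "p \<in> smooth_products \<Longrightarrow>
     \<exists>q\<in>smooth_products. \<forall>t. (p has_vector_derivative q t) (at t)"
proof (induction rule: smooth_products.induct)
  case (times f g)
  then have "(\<lambda>t. f t * time_derivative_fun g t + time_derivative_fun f t * g t)
      \<in> smooth_products"
    by (intro smooth_products.intros smooth_derivative)
  then show ?case
    by (rule bexI[rotated])
      (intro allI has_vector_derivative_mult smooth_has_derivative times)
next
  case (plus p q)
  then obtain p' q' where "p' \<in> smooth_products" "q' \<in> smooth_products"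
    and "\<And>t. (p has_vector_derivative p' t) (at t)" "\<And>t. (q has_vector_derivative q' t) (at t)"
    by blast
  then show ?case
    by (intro bexI[of _ "\<lambda>t. p' t + q' t"] allI has_vector_derivative_add smooth_products.plus)
qed

text \<open>Smoothness is the greatest property that makes a function differentiable and is inherited by its
derivative.\<close>

lemma smooth_coinduct:
  assumes "f \<in> S" and S: "\<And>g. g \<in> S \<Longrightarrow> \<exists>h\<in>S. \<forall>t. (g has_vector_derivative h t) (at t)"
  shows "smooth f"
proof -
  have "(time_derivative_fun ^^ n) f \<in> S" for n
  proof (induction n)
    case (Suc n)
    then show ?case using S time_derivative_fun_eqI by (metis comp_apply funpow.simps(2))
  qed (use assms in simp)
  then show ?thesis
    unfolding smooth_def differentiable_on_def
    by (metis S differentiableI_vector)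
qed

lemma smooth_mult: "smooth f \<Longrightarrow> smooth g \<Longrightarrow> smooth (\<lambda>t. f t * g t)"
  by (rule smooth_coinduct[OF smooth_products.times smooth_products_derivative])

section \<open>Differentiation on the tensor product\<close>

text \<open>The graph of the time derivative on \<open>C\<^sup>\<infinity> \<otimes> V\<close>, built up by one elementary tensor at a time.
Being in the domain of this relation is the same as belonging to the tensor product, so a single
rule induction gives both closure of the tensor product under an operation and the derivative of
the result.\<close>

inductive has_time_derivative ::
  "('k::real_normed_field \<Rightarrow> 'a::ab_group_add \<Rightarrow> 'a) \<Rightarrow> 'a set
    \<Rightarrow> (real \<Rightarrow> 'a) \<Rightarrow> (real \<Rightarrow> 'a) \<Rightarrow> bool"
  for s V where
  zero: "has_time_derivative s V (\<lambda>t. 0) (\<lambda>t. 0)"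
| plus_elementary:
    "\<lbrakk>has_time_derivative s V \<xi> \<xi>'; smooth f; x \<in> V\<rbrakk> \<Longrightarrow>
       has_time_derivative s V (\<lambda>t. \<xi> t + s (f t) x) (\<lambda>t. \<xi>' t + s (time_derivative_fun f t) x)"

lemma has_time_derivative_sum:
  assumes "\<And>i. i < N \<Longrightarrow> smooth (f i) \<and> x i \<in> V"
  shows "has_time_derivative s V (\<lambda>t. \<Sum>i<(N::nat). s (f i t) (x i))
           (\<lambda>t. \<Sum>i<N. s (time_derivative_fun (f i) t) (x i))"
  using assms
proof (induction N)
  case (Suc N)
  then have "has_time_derivative s V (\<lambda>t. \<Sum>i<N. s (f i t) (x i))
      (\<lambda>t. \<Sum>i<N. s (time_derivative_fun (f i) t) (x i))" by simp
  then show ?case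
    using has_time_derivative.plus_elementary[of s V _ _ "f N" "x N"] Suc.prems by simp
qed (simp add: has_time_derivative.zero)

lemma has_time_derivative_representation:
  "has_time_derivative s V \<xi> \<xi>' \<Longrightarrow>
     \<exists>(N::nat) f x. (\<forall>i<N. smooth (f i) \<and> x i \<in> V) \<and>
        \<xi> = (\<lambda>t. \<Sum>i<N. s (f i t) (x i)) \<and>
        \<xi>' = (\<lambda>t. \<Sum>i<N. s (time_derivative_fun (f i) t) (x i))"
proof (induction rule: has_time_derivative.induct)
  case zero
  show ?case by (intro exI[of _ 0]) simp
next
  case (plus_elementary \<xi> \<xi>' g y)
  then obtain N f x where "\<forall>i<(N::nat). smooth (f i) \<and> x i \<in> V"
    "\<xi> = (\<lambda>t. \<Sum>i<N. s (f i t) (x i))"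
    "\<xi>' = (\<lambda>t. \<Sum>i<N. s (time_derivative_fun (f i) t) (x i))"
    by blast
  with plus_elementary.hyps show ?case
    by (intro exI[of _ "Suc N"] exI[of _ "f(N := g)"] exI[of _ "x(N := y)"]) auto
qed

lemma tensor_smooth_iff:
  "\<xi> \<in> tensor_smooth s V \<longleftrightarrow> (\<exists>\<xi>'. has_time_derivative s V \<xi> \<xi>')"
proof
  assume "\<xi> \<in> tensor_smooth s V"
  then show "\<exists>\<xi>'. has_time_derivative s V \<xi> \<xi>'"
    unfolding tensor_smooth_def using has_time_derivative_sum by blast
next
  assume "\<exists>\<xi>'. has_time_derivative s V \<xi> \<xi>'"
  then show "\<xi> \<in> tensor_smooth s V"
    unfolding tensor_smooth_def using has_time_derivative_representation by blast
qed

lemma has_time_derivative_tensor_smooth: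
  "has_time_derivative s V \<xi> \<xi>' \<Longrightarrow> \<xi> \<in> tensor_smooth s V"
  using tensor_smooth_iff by blast

text \<open>Although the derivative is applied only once in the differential, its value has to lie in the
tensor product again, hence be differentiable itself.\<close>

lemma has_time_derivative_derivative:
  "has_time_derivative s V \<xi> \<xi>' \<Longrightarrow> \<exists>\<xi>''. has_time_derivative s V \<xi>' \<xi>''"
  by (induction rule: has_time_derivative.induct)
    (blast intro: has_time_derivative.intros smooth_derivative)+

lemma time_derivative_eqI:
  assumes "vector_space s" "has_time_derivative s V \<xi> \<xi>'"
  shows "time_derivative s \<xi> = \<xi>'"
  using has_time_derivative_representation[OF assms(2)] time_derivative_eq[OF assms(1)] by blast

locale normed_field_space = vector_space smul
  for smul :: "'k::real_normed_field \<Rightarrow> 'a::ab_group_add \<Rightarrow> 'a"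
begin

lemma has_time_derivative_mem:
  "has_time_derivative smul V \<xi> \<xi>' \<Longrightarrow> subspace V \<Longrightarrow> \<xi> t \<in> V"
  by (induction rule: has_time_derivative.induct) (auto intro: subspace_add subspace_scale subspace_0)

lemma has_time_derivative_mem':
  "has_time_derivative smul V \<xi> \<xi>' \<Longrightarrow> subspace V \<Longrightarrow> \<xi>' t \<in> V"
  by (meson has_time_derivative_derivative has_time_derivative_mem)

lemma has_time_derivative_add:
  assumes \<xi>: "has_time_derivative smul V \<xi> \<xi>'" and \<eta>: "has_time_derivative smul V \<eta> \<eta>'"
  shows "has_time_derivative smul V (\<lambda>t. \<xi> t + \<eta> t) (\<lambda>t. \<xi>' t + \<eta>' t)"
  using \<eta>
proof induction
  case (plus_elementary \<eta> \<eta>' f x)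
  from has_time_derivative.plus_elementary[OF plus_elementary.IH plus_elementary.hyps(2,3)]
  show ?case by (simp add: add.assoc)
qed (use \<xi> in simp)

lemma has_time_derivative_linear:
  assumes f: "linear_on smul V smul W h" and V: "subspace V"
    and \<xi>: "has_time_derivative smul V \<xi> \<xi>'"
  shows "has_time_derivative smul W (\<lambda>t. h (\<xi> t)) (\<lambda>t. h (\<xi>' t))"
  using \<xi>
proof induction
  case zero
  have "h 0 = 0"
    using f subspace_0[OF V] unfolding linear_on_def by (metis scale_zero_left)
  then show ?case by (simp add: has_time_derivative.zero)
next
  case (plus_elementary \<xi> \<xi>' g x)
  have "h (\<xi> t + smul c x) = h (\<xi> t) + smul c (h x)"
    "h (\<xi>' t + smul c x) = h (\<xi>' t) + smul c (h x)" for t c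
    using f plus_elementary.hyps V unfolding linear_on_def
    by (simp_all add: has_time_derivative_mem has_time_derivative_mem' subspace_scale)
  moreover have "h x \<in> W" using f plus_elementary.hyps unfolding linear_on_def by blast
  ultimately show ?case
    using plus_elementary has_time_derivative.plus_elementary by simp
qed

lemma linear_on_scale: "subspace V \<Longrightarrow> linear_on smul V smul V (smul c)"
  by (auto simp: linear_on_def subspace_scale scale_right_distrib mult.commute)

lemma has_time_derivative_scale:
  "subspace V \<Longrightarrow> has_time_derivative smul V \<xi> \<xi>' \<Longrightarrow>
     has_time_derivative smul V (\<lambda>t. smul c (\<xi> t)) (\<lambda>t. smul c (\<xi>' t))"
  by (rule has_time_derivative_linear[OF linear_on_scale])

lemma has_time_derivative_smooth_mult:
  assumes g: "smooth g" and \<xi>: "has_time_derivative smul V \<xi> \<xi>'"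
  shows "has_time_derivative smul V (\<lambda>t. smul (g t) (\<xi> t))
           (\<lambda>t. smul (time_derivative_fun g t) (\<xi> t) + smul (g t) (\<xi>' t))"
  using \<xi>
proof induction
  case zero
  show ?case by (simp add: has_time_derivative.zero)
next
  case (plus_elementary \<xi> \<xi>' f x)
  from has_time_derivative.plus_elementary[OF plus_elementary.IH
      smooth_mult[OF g plus_elementary.hyps(2)] plus_elementary.hyps(3)]
  show ?case
    by (simp add: time_derivative_fun_mult[OF g plus_elementary.hyps(2)] scale_right_distrib
        scale_left_distrib add_ac)
qed

text \<open>For an elementary tensor \<open>f x\<close> on the left, the product \<open>b (f x) \<eta> = f (b x \<eta>)\<close> is the
image of \<open>\<eta>\<close> under a linear map, multiplied by a smooth function; both operations are covered
above, so induction over \<open>\<xi>\<close> alone suffices.\<close>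

lemma has_time_derivative_bilinear:
  assumes left: "\<And>y. y \<in> W \<Longrightarrow> linear_on smul V smul U (\<lambda>x. b x y)"
    and right: "\<And>x. x \<in> V \<Longrightarrow> linear_on smul W smul U (b x)"
    and V: "subspace V" and W: "subspace W"
    and \<xi>: "has_time_derivative smul V \<xi> \<xi>'" and \<eta>: "has_time_derivative smul W \<eta> \<eta>'"
  shows "has_time_derivative smul U (\<lambda>t. b (\<xi> t) (\<eta> t)) (\<lambda>t. b (\<xi>' t) (\<eta> t) + b (\<xi> t) (\<eta>' t))"
  using \<xi>
proof induction
  case zero
  have "b 0 y = 0" if "y \<in> W" for y
    using left[OF that] subspace_0[OF V] unfolding linear_on_def by (metis scale_zero_left)
  then show ?case
    using \<eta> W by (simp add: has_time_derivative.zero has_time_derivative_mem has_time_derivative_mem')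
next
  case (plus_elementary \<xi> \<xi>' f x)
  have expand: "b (z + smul c x) y = b z y + smul c (b x y)" if "z \<in> V" "y \<in> W" for z y c
    using left[OF that(2)] that(1) plus_elementary.hyps(3) V unfolding linear_on_def
    by (simp add: subspace_scale)
  note mem = has_time_derivative_mem[OF plus_elementary.hyps(1) V]
    has_time_derivative_mem'[OF plus_elementary.hyps(1) V]
    has_time_derivative_mem[OF \<eta> W] has_time_derivative_mem'[OF \<eta> W]
  have "has_time_derivative smul U (\<lambda>t. b x (\<eta> t)) (\<lambda>t. b x (\<eta>' t))"
    by (rule has_time_derivative_linear[OF right W \<eta>]) (rule plus_elementary.hyps(3))
  from has_time_derivative_add[OF plus_elementary.IH
      has_time_derivative_smooth_mult[OF plus_elementary.hyps(2) this]]
  show ?case by (simp add: expand mem add_ac)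
qed

end

section \<open>Transport of structure\<close>

text \<open>Every axiom for the primed operations is the image under \<open>\<phi>\<close> of the same axiom for the given
ones, since each element of \<open>F' n\<close> has the form \<open>\<phi> n x\<close>.\<close>

lemma dga_transport:
  fixes s :: "'k::field \<Rightarrow> 'a::ab_group_add \<Rightarrow> 'a" and s' :: "'k \<Rightarrow> 'b::ab_group_add \<Rightarrow> 'b"
  assumes dga: "dga s F d w" and s': "vector_space s'"
    and lin: "\<And>n. linear_on s (F n) s' (F' n) (\<phi> n)"
    and bij: "\<And>n. bij_betw (\<phi> n) (F n) (F' n)"
    and diff: "\<And>n x. x \<in> F n \<Longrightarrow> \<phi> (n + 1) (d n x) = d' n (\<phi> n x)"
    and prod: "\<And>n m x y. x \<in> F n \<Longrightarrow> y \<in> F m \<Longrightarrow> \<phi> (n + m) (w n m x y) = w' n m (\<phi> n x) (\<phi> m y)"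
  shows "dga_isomorphism s F d w s' F' d' w' \<phi>"
proof -
  interpret A: dga s F d w by fact
  interpret B: vector_space s' by fact
  have surj: "F' n = \<phi> n ` F n" for n using bij by (simp add: bij_betw_def)
  have add: "\<phi> n (x + y) = \<phi> n x + \<phi> n y" if "x \<in> F n" "y \<in> F n" for n x y
    using lin that by (simp add: linear_on_def)
  have scl: "\<phi> n (s c x) = s' c (\<phi> n x)" if "x \<in> F n" for n c x
    using lin that by (simp add: linear_on_def)
  have zero: "\<phi> n 0 = 0" for n
    using scl[OF A.subspace_0[OF A.subspace_F], of n 0] by simp
  note mem = A.subspace_add[OF A.subspace_F] A.subspace_scale[OF A.subspace_F]
  have d: "d n x \<in> F (n + 1)" "d n (x + y) = d n x + d n y" "d n (s c x) = s c (d n x)"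
    if "x \<in> F n" "y \<in> F n" for n x y c
    using A.d_linear[of n] that by (auto simp: linear_on_def)
  have wl: "w n m x y \<in> F (n + m)" "w n m (x + x') y = w n m x y + w n m x' y"
    "w n m (s c x) y = s c (w n m x y)"
    if "x \<in> F n" "x' \<in> F n" "y \<in> F m" for n m x x' y c
    using A.wedge_linear_left[of y m n] that by (auto simp: linear_on_def)
  have wr: "w n m x (y + y') = w n m x y + w n m x y'"
    "w n m x (s c y) = s c (w n m x y)"
    if "x \<in> F n" "y \<in> F m" "y' \<in> F m" for n m x y y' c
    using A.wedge_linear_right[of x n m] that by (auto simp: linear_on_def)
  have target: "dga s' F' d' w'"
  proof (unfold_locales)
    show "B.subspace (F' n)" for n
      unfolding B.subspace_def surj
      by (auto simp: add[symmetric] scl[symmetric] intro!: imageI mem)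
         (metis zero imageI A.subspace_0[OF A.subspace_F])
    show "F' n = {0}" if "n < 0" for n
      using A.F_negative[OF that] by (simp add: surj zero)
    show "linear_on s' (F' n) s' (F' (n + 1)) (d' n)" for n
      unfolding linear_on_def surj
      by (auto simp: diff[symmetric] add[symmetric] scl[symmetric] mem d)
    show "linear_on s' (F' n) s' (F' (n + m)) (\<lambda>x. w' n m x y)" if "y \<in> F' m" for y n m
      using that unfolding linear_on_def surj
      by (auto simp: prod[symmetric] add[symmetric] scl[symmetric] mem wl)
    show "linear_on s' (F' m) s' (F' (n + m)) (w' n m x)" if "x \<in> F' n" for x n m
      using that unfolding linear_on_def surj
      by (auto simp: prod[symmetric] add[symmetric] scl[symmetric] mem wl wr)
    show "w' (n + m) l (w' n m x y) z = w' n (m + l) x (w' m l y z)"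
      if "x \<in> F' n" "y \<in> F' m" "z \<in> F' l" for x y z n m l
      using that unfolding surj
      by (auto simp: prod[symmetric] wl A.wedge_assoc add.assoc)
    show "d' (n + 1) (d' n x) = 0" if "x \<in> F' n" for x n
      using that unfolding surj by (auto simp: diff[symmetric] d A.d_d zero)
    show "d' (n + m) (w' n m x y) = w' (n + 1) m (d' n x) y + s' ((-1) powi n) (w' n (m + 1) x (d' m y))"
      if xy: "x \<in> F' n" "y \<in> F' m" for x y n m
    proof -
      obtain a b where ab: "a \<in> F n" "b \<in> F m" "x = \<phi> n a" "y = \<phi> m b"
        using xy unfolding surj by blast
      have da: "d n a \<in> F (n + 1)" and db: "d m b \<in> F (m + 1)"
        using ab d(1) by blast+
      have 1: "w (n + 1) m (d n a) b \<in> F (n + m + 1)" "w n (m + 1) a (d m b) \<in> F (n + m + 1)"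
        using wl(1)[OF da da ab(2)] wl(1)[OF ab(1,1) db] by (simp_all add: ac_simps)
      have "d' (n + m) (w' n m x y) = \<phi> (n + m + 1) (d (n + m) (w n m a b))"
        using ab wl by (simp add: prod[symmetric] diff[symmetric])
      also have "\<dots> = \<phi> (n + m + 1) (w (n + 1) m (d n a) b)
          + s' ((-1) powi n) (\<phi> (n + m + 1) (w n (m + 1) a (d m b)))"
        using ab 1 by (simp add: A.Leibniz add scl mem)
      also have "\<phi> (n + m + 1) (w (n + 1) m (d n a) b) = w' (n + 1) m (d' n x) y"
        using prod[OF da ab(2)] ab by (simp add: diff[symmetric] ac_simps)
      also have "\<phi> (n + m + 1) (w n (m + 1) a (d m b)) = w' n (m + 1) x (d' m y)"
        using prod[OF ab(1) db] ab by (simp add: diff[symmetric] ac_simps)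
      finally show ?thesis .
    qed
  qed
  interpret B: dga s' F' d' w' by (fact target)
  show ?thesis by unfold_locales (use lin bij diff prod in auto)
qed

section \<open>The undeformed algebra\<close>

text \<open>With these rules every sign becomes a product of the signs of the basic degrees in which squares
cancel; a difference of degrees is treated as a sum because signs are their own inverses.\<close>

lemma powi_minus_one_simps:
  "((-1)::'k::field) powi (n + m) = (-1) powi n * (-1) powi m"
  "((-1)::'k) powi (n - m) = (-1) powi n * (-1) powi m"
  "((-1)::'k) powi n * (-1) powi n = 1"
  "((-1)::'k) powi n * ((-1) powi n * c) = c"
proof -
  show *: "((-1)::'k) powi n * (-1) powi n = 1" for n
    by (cases "even n") (auto simp: power_int_minus_left)
  then show "((-1)::'k) powi n * ((-1) powi n * c) = c"
    by (metis mult.assoc mult_1)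
  show "((-1)::'k) powi (n + m) = (-1) powi n * (-1) powi m"
    by (simp add: power_int_add)
  show "((-1)::'k) powi (n - m) = (-1) powi n * (-1) powi m"
    using *[of m] by (simp add: power_int_diff field_simps)
qed

lemma vector_space_smul_R: "vector_space s \<Longrightarrow> vector_space (smul_R s)"
  unfolding vector_space_def smul_R_def by (auto simp: fun_eq_iff)

locale dga_homotopy = dga smul F d wedge
  for smul :: "'k::real_normed_field \<Rightarrow> 'a::ab_group_add \<Rightarrow> 'a"
    and F :: "int \<Rightarrow> 'a set"
    and d :: "int \<Rightarrow> 'a \<Rightarrow> 'a"
    and wedge :: "int \<Rightarrow> int \<Rightarrow> 'a \<Rightarrow> 'a \<Rightarrow> 'a" +
  fixes \<delta> :: "int \<Rightarrow> 'a \<Rightarrow> 'a"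
  assumes \<delta>_linear: "linear_on smul (F n) smul (F (n - 1)) (\<delta> n)"
begin

sublocale normed_field_space smul
  by unfold_locales

lemmas F_mem = subspace_add[OF subspace_F] subspace_scale[OF subspace_F]
  subspace_diff[OF subspace_F] subspace_neg[OF subspace_F] subspace_0[OF subspace_F]

lemma linear_on_diff:
  assumes "linear_on smul V smul W f" "subspace V" "x \<in> V" "y \<in> V"
  shows "f (x - y) = f x - f y"
proof -
  have "f ((x - y) + y) = f (x - y) + f y"
    using assms(1) subspace_diff[OF assms(2-4)] assms(4) unfolding linear_on_def by blast
  then show ?thesis by simp
qed

lemma d_simps:
  assumes "x \<in> F n"
  shows "d n x \<in> F (n + 1)"
    and "d n (smul c x) = smul c (d n x)"
    and "y \<in> F n \<Longrightarrow> d n (x + y) = d n x + d n y"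
    and "y \<in> F n \<Longrightarrow> d n (x - y) = d n x - d n y"
  using assms d_linear[of n] linear_on_diff[OF d_linear subspace_F]
  by (auto simp: linear_on_def)

lemma d_pred_mem: "x \<in> F (n - 1) \<Longrightarrow> d (n - 1) x \<in> F n"
  using d_simps(1)[of x "n - 1"] by simp

lemma d_d_pred: "x \<in> F (n - 1) \<Longrightarrow> d n (d (n - 1) x) = 0"
  using d_d[of x "n - 1"] by simp

lemma \<delta>_simps:
  assumes "x \<in> F n"
  shows "\<delta> n x \<in> F (n - 1)"
    and "\<delta> n (smul c x) = smul c (\<delta> n x)"
    and "y \<in> F n \<Longrightarrow> \<delta> n (x + y) = \<delta> n x + \<delta> n y"
  using assms \<delta>_linear[of n] by (auto simp: linear_on_def)

lemma wedge_simps: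
  assumes x: "x \<in> F n" and y: "y \<in> F m"
  shows "wedge n m x y \<in> F (n + m)"
    and "wedge n m (smul c x) y = smul c (wedge n m x y)"
    and "wedge n m x (smul c y) = smul c (wedge n m x y)"
    and "x' \<in> F n \<Longrightarrow> wedge n m (x + x') y = wedge n m x y + wedge n m x' y"
    and "x' \<in> F n \<Longrightarrow> wedge n m (x - x') y = wedge n m x y - wedge n m x' y"
    and "y' \<in> F m \<Longrightarrow> wedge n m x (y + y') = wedge n m x y + wedge n m x y'"
    and "y' \<in> F m \<Longrightarrow> wedge n m x (y - y') = wedge n m x y - wedge n m x y'"
  using assms wedge_linear_left[OF y, of n] wedge_linear_right[OF x, of m]
    linear_on_diff[OF wedge_linear_left[OF y] subspace_F]
    linear_on_diff[OF wedge_linear_right[OF x] subspace_F]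
  by (auto simp: linear_on_def)

lemma wedge_pred_mem:
  "x \<in> F (n - 1) \<Longrightarrow> y \<in> F m \<Longrightarrow> wedge (n - 1) m x y \<in> F (n + m - 1)"
  "x \<in> F n \<Longrightarrow> y \<in> F (m - 1) \<Longrightarrow> wedge n (m - 1) x y \<in> F (n + m - 1)"
  using wedge_simps(1)[of x "n - 1" y m] wedge_simps(1)[of x n y "m - 1"]
  by (simp_all add: algebra_simps)

text \<open>In degree \<open>n\<close> the coefficient of \<open>dt\<close> has degree \<open>n - 1\<close>. The axioms are restated at such
shifted degrees with the total degree in the form \<open>n + m - 1\<close>, the form in which it occurs in the
operations with a \<open>dt\<close>; the indices of the graded operations would not match otherwise.\<close>

lemma Leibniz_pred:
  "x \<in> F (n - 1) \<Longrightarrow> y \<in> F m \<Longrightarrow> d (n + m - 1) (wedge (n - 1) m x y) =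
     wedge n m (d (n - 1) x) y - smul ((-1) powi n) (wedge (n - 1) (m + 1) x (d m y))"
  "x \<in> F n \<Longrightarrow> y \<in> F (m - 1) \<Longrightarrow> d (n + m - 1) (wedge n (m - 1) x y) =
     wedge (n + 1) (m - 1) (d n x) y + smul ((-1) powi n) (wedge n m x (d (m - 1) y))"
  using Leibniz[of x "n - 1" y m] Leibniz[of x n y "m - 1"]
  by (simp_all add: powi_minus_one_simps add_diff_eq diff_add_eq)

lemma wedge_assoc_pred:
  "x \<in> F (n - 1) \<Longrightarrow> y \<in> F m \<Longrightarrow> z \<in> F l \<Longrightarrow>
     wedge (n + m - 1) l (wedge (n - 1) m x y) z = wedge (n - 1) (m + l) x (wedge m l y z)"
  "x \<in> F n \<Longrightarrow> y \<in> F (m - 1) \<Longrightarrow> z \<in> F l \<Longrightarrow>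
     wedge (n + m - 1) l (wedge n (m - 1) x y) z = wedge n (m + l - 1) x (wedge (m - 1) l y z)"
  "x \<in> F n \<Longrightarrow> y \<in> F m \<Longrightarrow> z \<in> F (l - 1) \<Longrightarrow>
     wedge (n + m) (l - 1) (wedge n m x y) z = wedge n (m + l - 1) x (wedge m (l - 1) y z)"
  using wedge_assoc[of x "n - 1" y m z l] wedge_assoc[of x n y "m - 1" z l]
    wedge_assoc[of x n y m z "l - 1"]
  by (simp_all add: add_diff_eq diff_add_eq)

lemma F_R_E:
  assumes "u \<in> F_R smul F n"
  obtains \<xi> \<xi>' \<eta> \<eta>' where "u = (\<xi>, \<eta>)"
    and "has_time_derivative smul (F n) \<xi> \<xi>'" and "has_time_derivative smul (F (n - 1)) \<eta> \<eta>'"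
  using assms unfolding F_R_def tensor_smooth_iff by (auto simp: tensor_smooth_iff)

lemma F_R_I:
  "has_time_derivative smul (F n) \<xi> \<xi>' \<Longrightarrow> has_time_derivative smul (F (n - 1)) \<eta> \<eta>' \<Longrightarrow>
     (\<xi>, \<eta>) \<in> F_R smul F n"
  unfolding F_R_def by (auto intro: has_time_derivative_tensor_smooth)

text \<open>Normalisation of sums of vectors only: the corresponding rules for integers would also rearrange
the degrees that index the operations.\<close>

lemmas vector_ac = add_ac[where 'a='a] add_diff_eq[where 'a='a] diff_add_eq[where 'a='a]
  diff_diff_eq[where 'a='a] diff_diff_eq2[where 'a='a] diff_eq_eq[where 'a='a]
  eq_diff_eq[where 'a='a]

lemma with_dt_add: "(\<xi>, \<rho>) + (\<eta>, \<sigma>) = ((\<lambda>t. \<xi> t + \<eta> t, \<lambda>t. \<rho> t + \<sigma> t) :: 'a with_dt)"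
  by (simp add: plus_fun_def)

lemma smul_R_pair: "smul_R smul c (\<xi>, \<rho>) = (\<lambda>t. smul c (\<xi> t), \<lambda>t. smul c (\<rho> t))"
  by (simp add: smul_R_def)

lemmas has_time_derivative_value = has_time_derivative_mem[OF _ subspace_F]
  has_time_derivative_mem'[OF _ subspace_F]

lemmas time_derivative_simp = time_derivative_eqI[OF vector_space_axioms]

lemmas has_time_derivative_F_scale = has_time_derivative_scale[OF subspace_F]

lemmas has_time_derivative_d = has_time_derivative_linear[OF d_linear subspace_F]

lemmas has_time_derivative_\<delta> = has_time_derivative_linear[OF \<delta>_linear subspace_F]

lemma has_time_derivative_wedge:
  "has_time_derivative smul (F n) \<xi> \<xi>' \<Longrightarrow> has_time_derivative smul (F m) \<eta> \<eta>' \<Longrightarrow>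
     has_time_derivative smul (F (n + m)) (\<lambda>t. wedge n m (\<xi> t) (\<eta> t))
       (\<lambda>t. wedge n m (\<xi>' t) (\<eta> t) + wedge n m (\<xi> t) (\<eta>' t))"
  by (rule has_time_derivative_bilinear[OF wedge_linear_left wedge_linear_right
        subspace_F subspace_F])

lemma subspace_F_R: "module.subspace (smul_R smul) (F_R smul F n)"
proof -
  interpret R: vector_space "smul_R smul" by (rule vector_space_smul_R) unfold_locales
  show ?thesis
    unfolding R.subspace_def
  proof safe
    show "0 \<in> F_R smul F n"
      using F_R_I[OF has_time_derivative.zero has_time_derivative.zero]
      by (simp add: zero_prod_def zero_fun_def)
  next
    fix a b x y assume "(a, b) \<in> F_R smul F n" "(x, y) \<in> F_R smul F n"
    then show "(a, b) + (x, y) \<in> F_R smul F n"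
      by (auto elim!: F_R_E simp: plus_fun_def intro: F_R_I has_time_derivative_add)
  next
    fix c x y assume "(x, y) \<in> F_R smul F n"
    then show "smul_R smul c (x, y) \<in> F_R smul F n"
      by (auto elim!: F_R_E simp: smul_R_def intro: F_R_I has_time_derivative_F_scale)
  qed
qed

lemma d_deformed_eq:
  "has_time_derivative smul V \<xi> \<xi>' \<Longrightarrow> d_deformed smul d \<delta> \<alpha> n (\<xi>, \<eta>) =
     (\<lambda>t. d n (\<xi> t),
      \<lambda>t. smul ((-1) powi n) (\<xi>' t) + smul ((-1) powi n * of_real \<alpha>) (Laplacian d \<delta> n (\<xi> t))
          + d (n - 1) (\<eta> t))"
  by (simp add: d_deformed_def time_derivative_simp)

lemma wedge_undeformed_eq:
  "wedge_deformed smul wedge \<delta> 0 n m (\<xi>, \<xi>') (\<eta>, \<eta>') =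
     (\<lambda>t. wedge n m (\<xi> t) (\<eta> t),
      \<lambda>t. smul ((-1) powi m) (wedge (n - 1) m (\<xi>' t) (\<eta> t)) + wedge n (m - 1) (\<xi> t) (\<eta>' t))"
  by (simp add: wedge_deformed_def)

lemma d_undeformed_mem:
  assumes "u \<in> F_R smul F n"
  shows "d_deformed smul d \<delta> 0 n u \<in> F_R smul F (n + 1)"
proof -
  obtain \<xi> \<xi>' \<eta> \<eta>' where u: "u = (\<xi>, \<eta>)"
    and \<xi>: "has_time_derivative smul (F n) \<xi> \<xi>'"
    and \<eta>: "has_time_derivative smul (F (n - 1)) \<eta> \<eta>'"
    using F_R_E[OF assms] .
  obtain \<xi>'' where \<xi>': "has_time_derivative smul (F n) \<xi>' \<xi>''"
    using has_time_derivative_derivative[OF \<xi>] ..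
  from has_time_derivative_add[OF has_time_derivative_F_scale[OF \<xi>'] has_time_derivative_d[OF \<eta>, simplified]]
  show ?thesis
    by (simp add: u d_deformed_eq[OF \<xi>]) (rule F_R_I[OF has_time_derivative_d[OF \<xi>]], simp)
qed

lemma wedge_undeformed_mem:
  assumes "u \<in> F_R smul F n" "v \<in> F_R smul F m"
  shows "wedge_deformed smul wedge \<delta> 0 n m u v \<in> F_R smul F (n + m)"
proof -
  obtain \<xi> \<xi>' \<rho> \<rho>' where u: "u = (\<xi>, \<rho>)"
    and \<xi>: "has_time_derivative smul (F n) \<xi> \<xi>'"
    and \<rho>: "has_time_derivative smul (F (n - 1)) \<rho> \<rho>'"
    using F_R_E[OF assms(1)] .
  obtain \<eta> \<eta>' \<sigma> \<sigma>' where v: "v = (\<eta>, \<sigma>)"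
    and \<eta>: "has_time_derivative smul (F m) \<eta> \<eta>'"
    and \<sigma>: "has_time_derivative smul (F (m - 1)) \<sigma> \<sigma>'"
    using F_R_E[OF assms(2)] .
  have "n - 1 + m = n + m - 1" "n + (m - 1) = n + m - 1" by simp_all
  then have
    "\<exists>\<zeta>. has_time_derivative smul (F (n + m - 1)) (\<lambda>t. wedge (n - 1) m (\<rho> t) (\<eta> t)) \<zeta>"
    "\<exists>\<zeta>. has_time_derivative smul (F (n + m - 1)) (\<lambda>t. wedge n (m - 1) (\<xi> t) (\<sigma> t)) \<zeta>"
    using has_time_derivative_wedge[OF \<rho> \<eta>] has_time_derivative_wedge[OF \<xi> \<sigma>] by metis+
  then obtain \<zeta> \<zeta>' where
    "has_time_derivative smul (F (n + m - 1))
       (\<lambda>t. smul ((-1) powi m) (wedge (n - 1) m (\<rho> t) (\<eta> t)) + wedge n (m - 1) (\<xi> t) (\<sigma> t))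
       (\<lambda>t. smul ((-1) powi m) (\<zeta> t) + \<zeta>' t)"
    using has_time_derivative_add has_time_derivative_F_scale by blast
  then show ?thesis
    unfolding u v wedge_undeformed_eq
    by (intro F_R_I[OF has_time_derivative_wedge[OF \<xi> \<eta>]]) assumption
qed

text \<open>The \<open>dt\<close>-coefficient carries all the content. Squaring the differential, the derivative term
occurs twice, with the opposite signs of the degrees \<open>n\<close> and \<open>n + 1\<close>, because \<open>d\<close> commutes
with the time derivative. In the Leibniz rule the terms with a time derivative match by the product
rule, and the sign \<open>(-1)\<^sup>m\<close> in \<open>(\<xi> \<and> dt) \<and> \<eta>\<close> is what moving \<open>dt\<close> past \<open>\<eta>\<close> costs.\<close>

lemma dga_undeformed:
  "dga (smul_R smul) (F_R smul F) (d_deformed smul d \<delta> 0) (wedge_deformed smul wedge \<delta> 0)"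
proof -
  let ?F = "F_R smul F" and ?d = "d_deformed smul d \<delta> 0" and ?w = "wedge_deformed smul wedge \<delta> 0"
  note pw = has_time_derivative_value
  interpret R: vector_space "smul_R smul" by (rule vector_space_smul_R) unfold_locales
  show ?thesis
  proof unfold_locales
    show "R.subspace (?F n)" for n by (rule subspace_F_R)
    show "?F n = {0}" if "n < 0" for n
    proof -
      have "u = 0" if "u \<in> ?F n" for u
        using that
      proof (rule F_R_E)
        fix \<xi> \<xi>' \<eta> \<eta>'
        assume *: "u = (\<xi>, \<eta>)" "has_time_derivative smul (F n) \<xi> \<xi>'"
          "has_time_derivative smul (F (n - 1)) \<eta> \<eta>'"
        show "u = 0"
          using pw(1)[OF *(2)] pw(1)[OF *(3)] \<open>n < 0\<close> F_negative[of n] F_negative[of "n - 1"]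
          by (auto simp: *(1) zero_prod_def)
      qed
      then show ?thesis using R.subspace_0[OF subspace_F_R] by blast
    qed
    show "linear_on (smul_R smul) (?F n) (smul_R smul) (?F (n + 1)) (?d n)" for n
    proof -
      have "?d n (u + v) = ?d n u + ?d n v" if u: "u \<in> ?F n" and v: "v \<in> ?F n" for u v
      proof -
        obtain \<xi> \<xi>' \<rho> \<rho>' where u: "u = (\<xi>, \<rho>)"
          and \<xi>: "has_time_derivative smul (F n) \<xi> \<xi>'"
          and \<rho>: "has_time_derivative smul (F (n - 1)) \<rho> \<rho>'"
          using F_R_E[OF u] .
        obtain \<eta> \<eta>' \<sigma> \<sigma>' where v: "v = (\<eta>, \<sigma>)"
          and \<eta>: "has_time_derivative smul (F n) \<eta> \<eta>'"
          and \<sigma>: "has_time_derivative smul (F (n - 1)) \<sigma> \<sigma>'"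
          using F_R_E[OF v] .
        show ?thesis
          using pw[OF \<xi>] pw[OF \<eta>] pw[OF \<rho>] pw[OF \<sigma>]
          unfolding u v with_dt_add d_deformed_eq[OF \<xi>] d_deformed_eq[OF \<eta>]
            d_deformed_eq[OF has_time_derivative_add[OF \<xi> \<eta>]]
          by (simp add: d_simps scale_right_distrib vector_ac)
      qed
      moreover have "?d n (smul_R smul c u) = smul_R smul c (?d n u)" if u: "u \<in> ?F n" for u c
      proof -
        obtain \<xi> \<xi>' \<rho> \<rho>' where u: "u = (\<xi>, \<rho>)"
          and \<xi>: "has_time_derivative smul (F n) \<xi> \<xi>'"
          and \<rho>: "has_time_derivative smul (F (n - 1)) \<rho> \<rho>'"
          using F_R_E[OF u] .
        show ?thesis
          using pw[OF \<xi>] pw[OF \<rho>]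
          unfolding u smul_R_pair d_deformed_eq[OF \<xi>]
            d_deformed_eq[OF has_time_derivative_F_scale[OF \<xi>]]
          by (simp add: d_simps scale_right_distrib mult.commute)
      qed
      ultimately show ?thesis
        by (auto simp: linear_on_def d_undeformed_mem)
    qed
    show "linear_on (smul_R smul) (?F n) (smul_R smul) (?F (n + m)) (\<lambda>u. ?w n m u v)"
      if v: "v \<in> ?F m" for v n m
    proof -
      obtain \<eta> \<eta>' \<sigma> \<sigma>' where v': "v = (\<eta>, \<sigma>)"
        and \<eta>: "has_time_derivative smul (F m) \<eta> \<eta>'"
        and \<sigma>: "has_time_derivative smul (F (m - 1)) \<sigma> \<sigma>'"
        using F_R_E[OF v] .
      show ?thesis
        unfolding linear_on_def
      proof (intro conjI ballI allI image_subsetI)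
        show "?w n m u v \<in> ?F (n + m)" if "u \<in> ?F n" for u
          by (rule wedge_undeformed_mem) fact+
      qed (use pw[OF \<eta>] pw[OF \<sigma>] in \<open>auto elim!: F_R_E simp: v' plus_fun_def smul_R_pair
            wedge_undeformed_eq pw wedge_simps scale_right_distrib mult.commute vector_ac\<close>)
    qed
    show "linear_on (smul_R smul) (?F m) (smul_R smul) (?F (n + m)) (?w n m u)"
      if u: "u \<in> ?F n" for u n m
    proof -
      obtain \<xi> \<xi>' \<rho> \<rho>' where u': "u = (\<xi>, \<rho>)"
        and \<xi>: "has_time_derivative smul (F n) \<xi> \<xi>'"
        and \<rho>: "has_time_derivative smul (F (n - 1)) \<rho> \<rho>'"
        using F_R_E[OF u] .
      show ?thesis
        unfolding linear_on_def
      proof (intro conjI ballI allI image_subsetI)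
        show "?w n m u v \<in> ?F (n + m)" if "v \<in> ?F m" for v
          by (rule wedge_undeformed_mem) fact+
      qed (use pw[OF \<xi>] pw[OF \<rho>] in \<open>auto elim!: F_R_E simp: u' plus_fun_def smul_R_pair
            wedge_undeformed_eq pw wedge_simps scale_right_distrib mult.commute vector_ac\<close>)
    qed
    show "?w (n + m) l (?w n m u v) z = ?w n (m + l) u (?w m l v z)"
      if u: "u \<in> ?F n" and v: "v \<in> ?F m" and z: "z \<in> ?F l" for u v z n m l
      using u v z
      by (auto elim!: F_R_E simp: wedge_undeformed_eq pw wedge_simps wedge_pred_mem F_mem
          wedge_assoc wedge_assoc_pred add_diff_eq[where 'a=int] scale_right_distrib powi_minus_one_simps
          mult_ac[where 'a='k] vector_ac)
    show "?d (n + 1) (?d n u) = 0" if u: "u \<in> ?F n" for u n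
    proof -
      obtain \<xi> \<xi>' \<rho> \<rho>' where u': "u = (\<xi>, \<rho>)"
        and \<xi>: "has_time_derivative smul (F n) \<xi> \<xi>'"
        and \<rho>: "has_time_derivative smul (F (n - 1)) \<rho> \<rho>'"
        using F_R_E[OF u] .
      show ?thesis
        using pw[OF \<xi>] pw[OF \<rho>]
        unfolding u' d_deformed_eq[OF \<xi>] d_deformed_eq[OF has_time_derivative_d[OF \<xi>]]
        by (simp add: d_simps d_pred_mem d_d d_d_pred F_mem powi_minus_one_simps zero_prod_def zero_fun_def)
    qed
    show "?d (n + m) (?w n m u v) =
        ?w (n + 1) m (?d n u) v + smul_R smul ((-1) powi n) (?w n (m + 1) u (?d m v))"
      if u: "u \<in> ?F n" and v: "v \<in> ?F m" for u v n m
    proof -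
      obtain \<xi> \<xi>' \<rho> \<rho>' where u': "u = (\<xi>, \<rho>)"
        and \<xi>: "has_time_derivative smul (F n) \<xi> \<xi>'"
        and \<rho>: "has_time_derivative smul (F (n - 1)) \<rho> \<rho>'"
        using F_R_E[OF u] .
      obtain \<eta> \<eta>' \<sigma> \<sigma>' where v': "v = (\<eta>, \<sigma>)"
        and \<eta>: "has_time_derivative smul (F m) \<eta> \<eta>'"
        and \<sigma>: "has_time_derivative smul (F (m - 1)) \<sigma> \<sigma>'"
        using F_R_E[OF v] .
      show ?thesis
        using pw[OF \<xi>] pw[OF \<rho>] pw[OF \<eta>] pw[OF \<sigma>]
        unfolding u' v' d_deformed_eq[OF \<xi>] d_deformed_eq[OF \<eta>] wedge_undeformed_eq
          d_deformed_eq[OF has_time_derivative_wedge[OF \<xi> \<eta>]] smul_R_pair with_dt_add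
        by (simp add: d_simps d_pred_mem wedge_simps wedge_pred_mem F_mem Leibniz Leibniz_pred
            fun_eq_iff powi_minus_one_simps scale_right_distrib scale_right_diff_distrib
            mult_ac[where 'a='k] vector_ac)
    qed
  qed
qed

section \<open>The shear intertwines the operations\<close>

lemma I_map_mem:
  assumes "u \<in> F_R smul F n"
  shows "I_map smul \<delta> \<alpha> n u \<in> F_R smul F n"
proof -
  obtain \<xi> \<xi>' \<eta> \<eta>' where u: "u = (\<xi>, \<eta>)"
    and \<xi>: "has_time_derivative smul (F n) \<xi> \<xi>'"
    and \<eta>: "has_time_derivative smul (F (n - 1)) \<eta> \<eta>'"
    using F_R_E[OF assms] .
  from has_time_derivative_add[OF \<eta> has_time_derivative_F_scale[OF has_time_derivative_\<delta>[OF \<xi>]],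
      of "- ((-1) powi n * of_real \<alpha>)"]
  show ?thesis
    by (simp add: u I_map_def F_R_I[OF \<xi>])
qed

lemma I_inverse_eq: "I_inverse smul \<delta> \<alpha> = I_map smul \<delta> (- \<alpha>)"
  by (auto simp: I_inverse_def I_map_def fun_eq_iff)

lemma I_map_uminus: "I_map smul \<delta> \<alpha> n (I_map smul \<delta> (- \<alpha>) n u) = u"
  by (auto simp: I_map_def split: prod.split)

lemma I_map_linear:
  "linear_on (smul_R smul) (F_R smul F n) (smul_R smul) (F_R smul F n) (I_map smul \<delta> \<alpha> n)"
  unfolding linear_on_def
proof (intro conjI ballI allI image_subsetI)
  show "I_map smul \<delta> \<alpha> n u \<in> F_R smul F n" if "u \<in> F_R smul F n" for u
    using that by (rule I_map_mem)
qed (auto elim!: F_R_E simp: plus_fun_def smul_R_pair I_map_def has_time_derivative_value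
      \<delta>_simps scale_right_distrib scale_right_diff_distrib mult_ac vector_ac)

lemma I_map_bij: "bij_betw (I_map smul \<delta> \<alpha> n) (F_R smul F n) (F_R smul F n)"
  by (rule bij_betw_byWitness[where f' = "I_map smul \<delta> (- \<alpha>) n"])
    (use I_map_uminus[of "- \<alpha>"] in \<open>auto simp: I_map_uminus I_map_mem\<close>)

text \<open>On the left the shear acts in degree \<open>n + 1\<close> and contributes \<open>\<delta> d\<close> with the sign of that
degree; on the right \<open>d\<close> acts on the sheared component and contributes \<open>d \<delta>\<close> with the
opposite sign. Their difference is the Laplacian term.\<close>

lemma I_map_differential:
  assumes "u \<in> F_R smul F n"
  shows "I_map smul \<delta> \<alpha> (n + 1) (d_deformed smul d \<delta> 0 n u) =
         d_deformed smul d \<delta> \<alpha> n (I_map smul \<delta> \<alpha> n u)"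
proof -
  obtain \<xi> \<xi>' \<eta> \<eta>' where u: "u = (\<xi>, \<eta>)"
    and \<xi>: "has_time_derivative smul (F n) \<xi> \<xi>'"
    and \<eta>: "has_time_derivative smul (F (n - 1)) \<eta> \<eta>'"
    using F_R_E[OF assms] .
  show ?thesis
    using has_time_derivative_value[OF \<xi>] has_time_derivative_value[OF \<eta>]
    by (simp add: u I_map_def d_deformed_eq[OF \<xi>] Laplacian_def \<delta>_simps d_simps F_mem
        powi_minus_one_simps scale_right_distrib vector_ac)
qed

text \<open>The left side contributes \<open>\<delta> (\<xi> \<and> \<eta>)\<close> and the shears of the two factors contribute
\<open>\<delta> \<xi> \<and> \<eta>\<close> and \<open>\<xi> \<and> \<delta> \<eta>\<close>; the sign \<open>(-1)\<^sup>m\<close> of the product with \<open>\<xi>' \<and> dt\<close>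
and the sign \<open>(-1)\<^sup>n\<close> of the first shear combine to the \<open>(-1)\<^sup>n\<^sup>+\<^sup>m\<close> of the deformation.\<close>

lemma I_map_product:
  assumes "u \<in> F_R smul F n" "v \<in> F_R smul F m"
  shows "I_map smul \<delta> \<alpha> (n + m) (wedge_deformed smul wedge \<delta> 0 n m u v) =
         wedge_deformed smul wedge \<delta> \<alpha> n m (I_map smul \<delta> \<alpha> n u) (I_map smul \<delta> \<alpha> m v)"
  using assms
  by (auto elim!: F_R_E simp: wedge_undeformed_eq wedge_deformed_def I_map_def
      has_time_derivative_value \<delta>_simps wedge_simps F_mem powi_minus_one_simps
      scale_right_distrib scale_right_diff_distrib mult_ac[where 'a='k] vector_ac)

end

theorem mainTheorem2:
  fixes smul :: "'k::real_normed_field \<Rightarrow> 'a::ab_group_add \<Rightarrow> 'a"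
    and F :: "int \<Rightarrow> 'a set"
    and d :: "int \<Rightarrow> 'a \<Rightarrow> 'a"
    and wedge :: "int \<Rightarrow> int \<Rightarrow> 'a \<Rightarrow> 'a \<Rightarrow> 'a"
    and \<delta> :: "int \<Rightarrow> 'a \<Rightarrow> 'a"
    and \<alpha> :: real
  assumes "dga smul F d wedge"
    and "\<And>n. linear_on smul (F n) smul (F (n - 1)) (\<delta> n)"
  shows "dga_isomorphism
           (smul_R smul) (F_R smul F) (d_deformed smul d \<delta> 0) (wedge_deformed smul wedge \<delta> 0)
           (smul_R smul) (F_R smul F) (d_deformed smul d \<delta> \<alpha>) (wedge_deformed smul wedge \<delta> \<alpha>)
           (I_map smul \<delta> \<alpha>)
         \<and> (\<forall>n. \<forall>u \<in> F_R smul F n.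
              I_inverse smul \<delta> \<alpha> n u \<in> F_R smul F n
              \<and> I_inverse smul \<delta> \<alpha> n (I_map smul \<delta> \<alpha> n u) = u
              \<and> I_map smul \<delta> \<alpha> n (I_inverse smul \<delta> \<alpha> n u) = u)"
proof -
  interpret dga smul F d wedge by fact
  interpret dga_homotopy smul F d wedge \<delta>
    by unfold_locales (rule assms(2))
  have "dga_isomorphism
           (smul_R smul) (F_R smul F) (d_deformed smul d \<delta> 0) (wedge_deformed smul wedge \<delta> 0)
           (smul_R smul) (F_R smul F) (d_deformed smul d \<delta> \<alpha>) (wedge_deformed smul wedge \<delta> \<alpha>)
           (I_map smul \<delta> \<alpha>)"
    by (intro dga_transport dga_undeformed vector_space_smul_R vector_space_axioms I_map_linear
        I_map_bij I_map_differential I_map_product)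
  moreover have "I_map smul \<delta> (- \<alpha>) n (I_map smul \<delta> \<alpha> n u) = u" for n u
    using I_map_uminus[of "- \<alpha>"] by simp
  ultimately show ?thesis
    by (simp add: I_inverse_eq I_map_mem I_map_uminus)
qed

end
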